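(* Let $K$ be a field of characteristic $0$, and suppose that $f(x), g(x) \in K[x]$ are polynomials such that $f^{-1}(\{0,1\}) = g^{-1}(\{0,1\})$ as sets with multiplicity. Then either $f(x) = g(x)$ or $f(x) = 1 - g(x)$.
   Context: For a polynomial $f$, $f^{-1}(\{0,1\})$ denotes the preimage of the set $\{0,1\}$ under $f$, regarded as a set with multiplicity (multiset): it is the union of the multiset of roots of $f(x)$ and the multiset of roots of $f(x)-1$.
   Formalization: The formal theorem takes preimages with multiplicity in the algebraic closure of K and assumes f and g are not both constant; the claim fails for constants such as f = 2, g = 3, and fails with roots in K only (x^2+5, x^2+6 over Q). *)

theory Defs
  imports
    "HOL-Computational_Algebra.Computational_Algebra"
    "HOL-Algebra.Algebraic_Closure_Type"
begin

(*
  Roots are taken in the algebraic closure of K: with roots in K alone,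
  x^2 + 5 and x^2 + 6 over the rationals would have the same (empty) preimage.
  The union is a multiset sum; the two multisets have no element in common.
  Since proots 0 = {#} by convention, this is the intended preimage unless
  f is one of the constants 0 and 1, whose true preimage is everything.
*)
definition preimage01 :: "'a :: field poly \<Rightarrow> 'a alg_closure multiset" where
  "preimage01 f = proots (map_poly to_ac f) + proots (map_poly to_ac f - 1)"

end

theory Submission
  imports Defs
begin

text \<open>
  Over the algebraic closure a polynomial is determined by its multiset of roots up to a
  nonzero scalar, so equality of the two preimages says
  \<open>f (f - 1) = c g (g - 1)\<close> for a constant \<open>c \<noteq> 0\<close> (lemma \<open>same_proots_imp_smult\<close>); comparing
  numbers of roots also shows that \<open>f\<close> and \<open>g\<close> have the same degree.

  Since \<open>4 f (f - 1) = (2 f - 1)\<^sup>2 - 1\<close>, completing the square turns this relation into the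
  Pell equation \<open>P\<^sup>2 - c Q\<^sup>2 = 1 - c\<close> with \<open>P = 2 f - 1\<close>, \<open>Q = 2 g - 1\<close>. The scalar \<open>c\<close> has a
  square root \<open>s\<close> in the closure, so the left-hand side splits as \<open>(P - s Q) (P + s Q)\<close>. If
  \<open>c \<noteq> 1\<close>, this product is a nonzero constant; then both factors are constant, and so is their
  sum \<open>2 P\<close>, which is impossible for a nonconstant \<open>f\<close> (lemma
  \<open>completing_square_scalar_eq_1\<close>). Hence \<open>c = 1\<close>, and \<open>(f - g) (f + g - 1) = 0\<close>.
\<close>

lemma proots_prod_linear_factors:
  "proots (\<Prod>x\<in>#A. [:-x, 1:]) = (A :: 'a :: idom multiset)"
proof (induction A)
  case (add x A)
  have "(\<Prod>x\<in>#A. [:-x, 1:]) \<noteq> 0"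
    by (auto simp: prod_mset_zero_iff)
  then show ?case
    using add by (simp add: proots_mult del: mult_pCons_left)
qed simp

lemma
  fixes p :: "'a :: alg_closed_field poly"
  assumes "p \<noteq> 0"
  shows alg_closed_eq_smult_prod_proots: "p = smult (lead_coeff p) (\<Prod>x\<in>#proots p. [:-x, 1:])"
    and alg_closed_size_proots_nonzero: "size (proots p) = degree p"
proof -
  obtain A where A: "size A = degree p" "p = smult (lead_coeff p) (\<Prod>x\<in>#A. [:-x, 1:])"
    using alg_closed_imp_factorization[OF assms] by blast
  have "proots p = proots (\<Prod>x\<in>#A. [:-x, 1:])"
    using assms by (subst A(2)) simp
  then have "proots p = A"
    by (simp add: proots_prod_linear_factors)
  then show "p = smult (lead_coeff p) (\<Prod>x\<in>#proots p. [:-x, 1:])"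
    and "size (proots p) = degree p"
    using A by simp_all
qed

lemma alg_closed_size_proots:
  "size (proots p) = degree (p :: 'a :: alg_closed_field poly)"
  by (cases "p = 0") (simp_all add: alg_closed_size_proots_nonzero)

lemma same_proots_imp_smult:
  fixes p q :: "'a :: alg_closed_field poly"
  assumes "p \<noteq> 0" "q \<noteq> 0" "proots p = proots q"
  obtains c where "c \<noteq> 0" "p = smult c q"
proof
  show "lead_coeff p / lead_coeff q \<noteq> 0"
    using assms by simp
  have "smult (lead_coeff p / lead_coeff q) q
        = smult (lead_coeff p) (\<Prod>x\<in>#proots q. [:-x, 1:])"
    by (subst (2) alg_closed_eq_smult_prod_proots[OF assms(2)]) (use assms in simp)
  also have "\<dots> = p"
    using alg_closed_eq_smult_prod_proots[OF assms(1)] assms(3) by simp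
  finally show "p = smult (lead_coeff p / lead_coeff q) q" ..
qed

lemma completed_square_difference:
  fixes F G s :: "'a :: comm_ring_1"
  shows "((2 * F - 1) - s * (2 * G - 1)) * ((2 * F - 1) + s * (2 * G - 1))
         = (1 - s * s) + 4 * (F * (F - 1) - s * s * (G * (G - 1)))"
  by (simp add: algebra_simps)

text \<open>
  Completing the square turns the proportionality into a Pell equation with a constant
  coefficient and right-hand side \<open>1 - c\<close>. Its left-hand side factors, and the factors of a
  nonzero constant are constant, so a nonconstant solution forces \<open>1 - c\<close> to vanish.
  Recovering \<open>F\<close> from the sum of the two factors requires dividing by 4.
\<close>
lemma completing_square_scalar_eq_1:
  fixes F G :: "'a :: alg_closed_field poly"
  assumes two: "(2 :: 'a) \<noteq> 0"
  assumes nonconst: "degree F \<noteq> 0"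
  assumes proportional: "F * (F - 1) = smult c (G * (G - 1))"
  shows "c = 1"
proof (rule ccontr)
  assume "c \<noteq> 1"
  obtain s where s: "s ^ 2 = c"
    using nth_root_exists[of 2 c] by auto
  define A where "A = (2 * F - 1) - [:s:] * (2 * G - 1)"
  define B where "B = (2 * F - 1) + [:s:] * (2 * G - 1)"
  have "A * B = (1 - [:s:] * [:s:]) + 4 * (F * (F - 1) - [:s:] * [:s:] * (G * (G - 1)))"
    unfolding A_def B_def by (rule completed_square_difference)
  also have "[:s:] * [:s:] = [:c:]"
    using s by (simp add: power2_eq_square)
  also have "F * (F - 1) = [:c:] * (G * (G - 1))"
    using proportional by simp
  finally have "A * B = 1 - [:c:]"
    by simp
  then have AB: "A * B = [:1 - c:]"
    by (simp add: one_pCons)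
  then have "A \<noteq> 0" "B \<noteq> 0"
    using \<open>c \<noteq> 1\<close> by auto
  then have "degree A + degree B = 0"
    using AB by (metis degree_mult_eq degree_pCons_0)
  then have "degree (A + B) = 0"
    using degree_add_le[of A 0 B] by simp
  moreover have "A + B + 2 = smult (2 * 2) F"
    unfolding A_def B_def by (simp add: numeral_poly algebra_simps)
  ultimately have "degree (smult (2 * 2) F) = 0"
    using degree_add_le[of "A + B" 0 2] by simp
  moreover have "(2 * 2 :: 'a) \<noteq> 0"
    using two no_zero_divisors by blast
  ultimately show False
    using nonconst by (metis degree_smult_eq)
qed

lemma proots_01_eq_imp_eq_or_reflected:
  fixes F G :: "'a :: alg_closed_field poly"
  assumes two: "(2 :: 'a) \<noteq> 0"
  assumes nonconst: "degree F \<noteq> 0 \<or> degree G \<noteq> 0"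
  assumes roots: "proots F + proots (F - 1) = proots G + proots (G - 1)"
  shows "F = G \<or> F = 1 - G"
proof -
  have deg: "degree (p - 1) = degree p" for p :: "'a poly"
    using degree_add_eq_left[of "-1" p] by (cases "degree p = 0") (auto elim!: degree_eq_zeroE
        simp: one_pCons diff_conv_add_uminus simp del: add_uminus_conv_diff)
  (* Counting roots equates the degrees and so excludes that just one of F and G is constant;
     this includes the constants 0 and 1, since proots 0 is empty, as is proots of any constant. *)
  have "size (proots F + proots (F - 1)) = size (proots G + proots (G - 1))"
    using roots by simp
  then have "degree F = degree G"
    by (simp add: alg_closed_size_proots deg)
  then have F: "degree F \<noteq> 0" and G: "degree G \<noteq> 0"
    using nonconst by auto
  then have nz: "F \<noteq> 0" "F - 1 \<noteq> 0" "G \<noteq> 0" "G - 1 \<noteq> 0"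
    by auto
  then have "proots (F * (F - 1)) = proots (G * (G - 1))"
    using roots by (simp add: proots_mult)
  then obtain c where c: "F * (F - 1) = smult c (G * (G - 1))"
    using same_proots_imp_smult[of "F * (F - 1)" "G * (G - 1)"] nz by (metis no_zero_divisors)
  then have "c = 1"
    using completing_square_scalar_eq_1[OF two F] by blast
  then have "F * (F - 1) = G * (G - 1)"
    using c by simp
  then have "(F - G) * (F - (1 - G)) = 0"
    by (simp add: algebra_simps)
  then show ?thesis
    by simp
qed

theorem theorem1p6:
  fixes f g :: "'a :: field_char_0 poly"
  assumes nonconstant: "degree f \<noteq> 0 \<or> degree g \<noteq> 0"
  assumes preimages_eq: "preimage01 f = preimage01 g"
  shows "f = g \<or> f = 1 - g"
proof -
  let ?h = "map_poly (to_ac :: 'a \<Rightarrow> 'a alg_closure)"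
  have "degree (?h p) = degree p" for p
    by (rule degree_map_poly) auto
  then have "?h f = ?h g \<or> ?h f = 1 - ?h g"
    using proots_01_eq_imp_eq_or_reflected[of "?h f" "?h g"] nonconstant preimages_eq
    by (simp add: preimage01_def)
  moreover have "1 - ?h g = ?h (1 - g)"
    by (intro poly_eqI) (simp add: coeff_map_poly)
  moreover have "?h p = ?h q \<Longrightarrow> p = q" for p q
    by (simp add: poly_eq_iff coeff_map_poly)
  ultimately show ?thesis
    by metis
qed

end
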